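(* Let $A\in\mathbb{R}^{n\times n}$ and let $AV=VH_{k+p}+r_{k+p}e_{k+p}^T$ be a $(k+p)$-step randomized Arnoldi factorization with starting vector $v_1$. Let $\mu_1,\dots,\mu_p$ be shifts, let $\psi_p(\lambda)=\prod_{i=1}^p(\lambda-\mu_i)$, and let $\mathcal{Q}=Q^1\cdots Q^p$ be the matrix accumulated by $p$ shifted QR steps applied to $H_{k+p}$ with these shifts. Then the updated starting vector satisfies $$V\mathcal{Q}e_1=\rho\,\psi_p(A)v_1$$ for a normalization constant $\rho$, and the subspace spanned by the truncated updated basis is $$\mathrm{span}\{V\mathcal{Q}[e_1,\dots,e_k]\}=\mathcal{K}_k(A,\rho\,\psi_p(A)v_1).$$
   Context: $\mathcal{K}_m(A,v)=\mathrm{span}\{v,Av,\dots,A^{m-1}v\}$; all inner products and norms are Euclidean; $e_j$ are canonical vectors of $\mathbb{R}^{k+p}$. For $\Omega\in\mathbb{R}^{d\times n}$: $\Omega$ is an $\epsilon$-embedding for a subspace $\mathcal{S}\subset\mathbb{R}^n$ (with $\epsilon\in[0,1)$) if $(1-\epsilon)\|x\|^2\le\|\Omega x\|^2\le(1+\epsilon)\|x\|^2$ for all $x\in\mathcal{S}$. Vectors $x,y$ are $\Omega$-orthogonal if $(\Omega x)^T(\Omega y)=0$; a matrix $V$ with $m$ columns is $\Omega$-orthonormal if $(\Omega V)^T(\Omega V)=I_m$. Randomized Arnoldi factorization of length $m$ (here $m=k+p$): given $v_1\in\mathbb{R}^n$ with $\|\Omega v_1\|=1$, let $\mathcal{K}_m=\mathcal{K}_m(A,v_1)$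 be of dimension $m$ and let $\Omega$ be an $\epsilon$-embedding for $\mathrm{span}\{\mathcal{K}_m,A\mathcal{K}_m\}$. The factorization is $AV=VH_m+r_me_m^T$, with $V\in\mathbb{R}^{n\times m}$ an $\Omega$-orthonormal basis of $\mathcal{K}_m$, $V(:,1)=v_1$, $H_m\in\mathbb{R}^{m\times m}$ upper Hessenberg with positive subdiagonal entries (unreduced), and $r_m\in\mathcal{K}_{m+1}(A,v_1)$ $\Omega$-orthogonal to $\mathcal{K}_m$. Shifted QR steps: set $H^+:=H_{k+p}$; for $i=1,\dots,p$, compute a QR factorization $H^+-\mu_iI=Q^iR^i$ with $Q^i$ orthogonal (unitary if complex shifts are used) and $R^i$ upper triangular, then replace $H^+$ by $(Q^i)^TH^+Q^i=R^iQ^i+\mu_iI$ (conjugate transpose in the complex case). Spans are over $\mathbb{C}$ when complex vectors occur. *)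

theory Defs
  imports
    "Jordan_Normal_Form.VS_Connect"
    "Jordan_Normal_Form.Schur_Decomposition"
    Complex_Main
begin

(* Vectors and matrices are those of Jordan_Normal_Form, so all indices start at 0: the
   canonical vector e_j is unit_vec m (j - 1), and V(:,1) is col V 0. *)

abbreviation vspan :: "nat \<Rightarrow> 'a::field vec set \<Rightarrow> 'a vec set" where
  "vspan n S \<equiv> LinearCombinations.module.span class_ring (module_vec TYPE('a) n) S"

abbreviation vsub :: "nat \<Rightarrow> 'a::field vec set \<Rightarrow> ('a, 'a vec) module" where
  "vsub n W \<equiv> (module_vec TYPE('a) n)\<lparr>carrier := W\<rparr>"

definition krylov :: "nat \<Rightarrow> nat \<Rightarrow> 'a::field mat \<Rightarrow> 'a vec \<Rightarrow> 'a vec set" where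
  "krylov n m A v = vspan n ((\<lambda>j. (A ^\<^sub>m j) *\<^sub>v v) ` {..<m})"

definition enorm :: "real vec \<Rightarrow> real" where
  "enorm x = sqrt (x \<bullet> x)"

definition eps_embedding :: "real \<Rightarrow> real mat \<Rightarrow> real vec set \<Rightarrow> bool" where
  "eps_embedding \<epsilon> \<Omega> S \<longleftrightarrow> 0 \<le> \<epsilon> \<and> \<epsilon> < 1 \<and>
     (\<forall>x\<in>S. (1 - \<epsilon>) * (enorm x)\<^sup>2 \<le> (enorm (\<Omega> *\<^sub>v x))\<^sup>2 \<and>
            (enorm (\<Omega> *\<^sub>v x))\<^sup>2 \<le> (1 + \<epsilon>) * (enorm x)\<^sup>2)"

definition sketch_orthogonal :: "real mat \<Rightarrow> real vec \<Rightarrow> real vec \<Rightarrow> bool" where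
  "sketch_orthogonal \<Omega> x y \<longleftrightarrow> (\<Omega> *\<^sub>v x) \<bullet> (\<Omega> *\<^sub>v y) = 0"

definition sketch_orthonormal :: "real mat \<Rightarrow> real mat \<Rightarrow> bool" where
  "sketch_orthonormal \<Omega> V \<longleftrightarrow> transpose_mat (\<Omega> * V) * (\<Omega> * V) = 1\<^sub>m (dim_col V)"

definition upper_hessenberg :: "'a::zero mat \<Rightarrow> bool" where
  "upper_hessenberg H \<longleftrightarrow> (\<forall>i < dim_row H. \<forall>j < dim_col H. j + 1 < i \<longrightarrow> H $$ (i, j) = 0)"

definition randomized_arnoldi ::
  "nat \<Rightarrow> nat \<Rightarrow> nat \<Rightarrow> real \<Rightarrow> real mat \<Rightarrow> real mat \<Rightarrow> real vec \<Rightarrow>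
   real mat \<Rightarrow> real mat \<Rightarrow> real vec \<Rightarrow> bool" where
  "randomized_arnoldi n d m \<epsilon> \<Omega> A v\<^sub>1 V H r \<longleftrightarrow>
     A \<in> carrier_mat n n \<and> \<Omega> \<in> carrier_mat d n \<and> v\<^sub>1 \<in> carrier_vec n \<and>
     V \<in> carrier_mat n m \<and> H \<in> carrier_mat m m \<and> r \<in> carrier_vec n \<and>
     enorm (\<Omega> *\<^sub>v v\<^sub>1) = 1 \<and>
     vectorspace.dim class_ring (vsub n (krylov n m A v\<^sub>1)) = m \<and>
     eps_embedding \<epsilon> \<Omega> (vspan n (krylov n m A v\<^sub>1 \<union> (\<lambda>x. A *\<^sub>v x) ` krylov n m A v\<^sub>1)) \<and>
     A * V = V * H + mat_of_cols n [r] * mat_of_rows m [unit_vec m (m - 1)] \<and>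
     sketch_orthonormal \<Omega> V \<and>
     vectorspace.basis class_ring (vsub n (krylov n m A v\<^sub>1)) (set (cols V)) \<and>
     col V 0 = v\<^sub>1 \<and>
     upper_hessenberg H \<and> (\<forall>i. i + 1 < m \<longrightarrow> H $$ (i + 1, i) > 0) \<and>
     r \<in> krylov n (m + 1) A v\<^sub>1 \<and> (\<forall>x \<in> krylov n m A v\<^sub>1. sketch_orthogonal \<Omega> r x)"

(* For real matrices mat_adjoint is the transpose, so this is orthogonality. *)
definition unitary_mat :: "nat \<Rightarrow> 'a::conjugatable_field mat \<Rightarrow> bool" where
  "unitary_mat m Q \<longleftrightarrow> Q \<in> carrier_mat m m \<and> mat_adjoint Q * Q = 1\<^sub>m m"

(* shifted_qr m H mus H' W: one possible run of the shifted QR steps started at H with the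
   shifts mus ends with H' and accumulates W = Q^1 ... Q^p. It is a relation because QR
   factorizations are not unique. *)
inductive shifted_qr ::
  "nat \<Rightarrow> 'a::conjugatable_field mat \<Rightarrow> 'a list \<Rightarrow> 'a mat \<Rightarrow> 'a mat \<Rightarrow> bool"
  for m where
  Nil: "shifted_qr m H [] H (1\<^sub>m m)"
| Cons: "\<lbrakk>unitary_mat m Q; R \<in> carrier_mat m m; upper_triangular R;
          H - \<mu> \<cdot>\<^sub>m 1\<^sub>m m = Q * R;
          shifted_qr m (mat_adjoint Q * H * Q) mus H' W\<rbrakk>
         \<Longrightarrow> shifted_qr m H (\<mu> # mus) H' (Q * W)"

definition shift_poly :: "'a::comm_ring_1 list \<Rightarrow> 'a poly" where
  "shift_poly mus = (\<Prod>\<mu>\<leftarrow>mus. [:- \<mu>, 1:])"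

definition poly_mat :: "'a::comm_ring_1 poly \<Rightarrow> 'a mat \<Rightarrow> 'a mat" where
  "poly_mat q A = mat (dim_row A) (dim_row A)
     (\<lambda>(i, j). \<Sum>l\<le>degree q. coeff q l * (A ^\<^sub>m l) $$ (i, j))"

end

theory Submission
  imports Defs
begin

text \<open>
  One QR step with shift \<open>\<mu>\<close> replaces the basis \<open>V\<close> by \<open>V\<^sup>+ = V Q\<close>, where \<open>H - \<mu> I = Q R\<close>. From
  \<open>(A - \<mu> I) V = V (H - \<mu> I) = V\<^sup>+ R\<close>, valid in all columns but the last, the first column gives
  \<open>(A - \<mu> I) v\<^sub>1 = R\<^sub>1\<^sub>1 v\<^sub>1\<^sup>+\<close>: each step multiplies the starting vector by one factor of the shift
  polynomial and divides it by a number, which is nonzero because \<open>H\<close> is unreduced.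

  The step also costs one column. Since \<open>H\<close> is Hessenberg with nonzero subdiagonal entries, so are
  the leading columns of \<open>Q\<close>, hence column \<open>c\<close> of \<open>V Q\<close> combines only the columns of \<open>V\<close> up to
  \<open>c + 1\<close>; and \<open>R Q + \<mu> I\<close> inherits the Hessenberg shape from \<open>Q\<close>. When \<open>\<mu>\<close> is an eigenvalue of
  \<open>H\<close>, the matrix \<open>R\<close> is singular and the last subdiagonal entry of the new \<open>H\<close> vanishes, so that
  later steps start from a reduced matrix and the shape of its trailing columns can no longer be
  relied on; but each step spoils at most the last of the columns still under control. The predicate \<open>arnoldi_prefix\<close> therefore records how many leading columns form an
  unreduced Arnoldi relation, and \<open>arnoldi_prefix_step\<close> shows that one step lowers this number by
  at most one. The \<open>p\<close> steps lead from \<open>k + p\<close> to \<open>k\<close>.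

  An unreduced Arnoldi relation on \<open>k\<close> columns means \<open>A v\<^sub>c = h v\<^sub>c\<^sub>+\<^sub>1 + y\<close> with \<open>h \<noteq> 0\<close> and \<open>y\<close> in the
  span of the preceding columns, so these columns span the Krylov space of the first one
  (\<open>krylov_eq_span\<close>). The argument is purely algebraic and works over every field with a
  conjugation; real and complex shifts are two instances of \<open>shifted_qr_krylov\<close>.
\<close>

section \<open>Krylov spaces as spans of recursively generated vectors\<close>

lemma (in vec_space) submodule_iff:
  "submodule class_ring N V \<longleftrightarrow> N \<subseteq> carrier_vec n \<and> 0\<^sub>v n \<in> N \<and>
     (\<forall>u\<in>N. \<forall>w\<in>N. u + w \<in> N) \<and> (\<forall>c. \<forall>u\<in>N. c \<cdot>\<^sub>v u \<in> N)"
  using module_axioms by (auto simp: submodule_def)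

lemma (in vec_space) span_closed_ops:
  assumes "S \<subseteq> carrier_vec n"
  shows "0\<^sub>v n \<in> span S"
    and "\<And>u w. u \<in> span S \<Longrightarrow> w \<in> span S \<Longrightarrow> u + w \<in> span S"
    and "\<And>c u. u \<in> span S \<Longrightarrow> c \<cdot>\<^sub>v u \<in> span S"
    and "\<And>u. u \<in> span S \<Longrightarrow> u \<in> carrier_vec n"
  using span_is_submodule[OF assms] unfolding submodule_iff by auto

lemma (in vec_space) mult_mat_vec_span:
  assumes A: "A \<in> carrier_mat n n" and S: "S \<subseteq> carrier_vec n" and T: "T \<subseteq> carrier_vec n"
    and ST: "\<And>x. x \<in> S \<Longrightarrow> A *\<^sub>v x \<in> span T" and x: "x \<in> span S"
  shows "A *\<^sub>v x \<in> span T"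
proof -
  let ?N = "{y \<in> carrier_vec n. A *\<^sub>v y \<in> span T}"
  have "A *\<^sub>v 0\<^sub>v n = 0\<^sub>v n"
    using A by auto
  then have "submodule class_ring ?N V"
    unfolding submodule_iff using A span_closed_ops[OF T]
    by (auto simp: mult_add_distrib_mat_vec[OF A] mult_mat_vec[OF A])
  moreover have "S \<subseteq> ?N"
    using S ST by auto
  ultimately have "span S \<subseteq> ?N"
    by (simp add: span_is_subset)
  with x show ?thesis by auto
qed

lemma mat_unit_vec_col:
  fixes M :: "'a::semiring_1 mat"
  assumes "M \<in> carrier_mat n m" and "j < m"
  shows "M *\<^sub>v unit_vec m j = col M j"
  using assms by (intro eq_vecI) auto

text \<open>Induction on \<open>t\<close>, peeling off the last coordinate of \<open>w\<close> that may be nonzero.\<close>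

lemma (in vec_space) mult_mat_vec_in_span_cols:
  assumes M: "M \<in> carrier_mat n m" and w: "w \<in> carrier_vec m" and t: "t \<le> m"
    and supp: "\<And>l. t \<le> l \<Longrightarrow> l < m \<Longrightarrow> w $ l = 0"
  shows "M *\<^sub>v w \<in> span (col M ` {..<t})"
  using w t supp
proof (induction t arbitrary: w)
  case 0
  then have "w = 0\<^sub>v m" by auto
  then have "M *\<^sub>v w = 0\<^sub>v n" using M by auto
  then show ?case using span_closed_ops(1)[of "{}"] by simp
next
  case (Suc t)
  define u where "u = vec m (\<lambda>l. if l = t then 0 else w $ l)"
  have u: "u \<in> carrier_vec m" unfolding u_def by simp
  have sub: "col M ` {..<Suc t} \<subseteq> carrier_vec n" using M by auto
  have "M *\<^sub>v u \<in> span (col M ` {..<t})"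
    using Suc.prems by (intro Suc.IH) (auto simp: u_def)
  then have 1: "M *\<^sub>v u \<in> span (col M ` {..<Suc t})"
    using span_is_monotone[of "col M ` {..<t}" "col M ` {..<Suc t}"] by (auto simp: lessThan_Suc)
  have "col M t \<in> span (col M ` {..<Suc t})"
    using in_own_span[OF sub] by auto
  then have 2: "w $ t \<cdot>\<^sub>v col M t \<in> span (col M ` {..<Suc t})"
    by (rule span_closed_ops(3)[OF sub])
  have "w = u + w $ t \<cdot>\<^sub>v unit_vec m t"
    using Suc.prems by (intro eq_vecI) (auto simp: u_def)
  then have "M *\<^sub>v w = M *\<^sub>v (u + w $ t \<cdot>\<^sub>v unit_vec m t)" by simp
  also have "\<dots> = M *\<^sub>v u + w $ t \<cdot>\<^sub>v col M t"
    using M u Suc.prems by (simp add: mult_add_distrib_mat_vec mult_mat_vec mat_unit_vec_col)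
  finally show ?case using span_closed_ops(2)[OF sub 1 2] by simp
qed


lemma pow_mat_Suc_mult_vec:
  fixes A :: "'a::comm_ring_1 mat"
  assumes A: "A \<in> carrier_mat n n" and v: "v \<in> carrier_vec n"
  shows "A *\<^sub>v (A ^\<^sub>m j *\<^sub>v v) = A ^\<^sub>m Suc j *\<^sub>v v"
    and "A ^\<^sub>m j *\<^sub>v (A *\<^sub>v v) = A ^\<^sub>m Suc j *\<^sub>v v"
proof -
  have P: "A ^\<^sub>m j \<in> carrier_mat n n" using A by simp
  show 2: "A ^\<^sub>m j *\<^sub>v (A *\<^sub>v v) = A ^\<^sub>m Suc j *\<^sub>v v"
    using assoc_mult_mat_vec[OF P A v] by simp
  have "A * A ^\<^sub>m j = A ^\<^sub>m j * A"
  proof (induction j)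
    case (Suc j)
    have P: "A ^\<^sub>m j \<in> carrier_mat n n" using A by simp
    show ?case using Suc assoc_mult_mat[OF A P A] by simp
  qed (use A in simp)
  then show "A *\<^sub>v (A ^\<^sub>m j *\<^sub>v v) = A ^\<^sub>m Suc j *\<^sub>v v"
    using assoc_mult_mat_vec[OF A P v] by simp
qed

text \<open>
  The hypothesis can be read in both directions: it expresses \<open>A (x c)\<close> through \<open>x 0, \<dots>, x (c + 1)\<close>,
  and, as \<open>h \<noteq> 0\<close>, it expresses \<open>x (c + 1)\<close> through \<open>A (x c)\<close> and the preceding vectors. Hence the
  spans of the first \<open>j\<close> of the \<open>x\<close> and of the first \<open>j\<close> Krylov vectors grow together.
\<close>

lemma (in vec_space) krylov_eq_span:
  assumes A: "A \<in> carrier_mat n n" and x: "\<And>c. c < k \<Longrightarrow> x c \<in> carrier_vec n"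
    and step: "\<And>c. c + 1 < k \<Longrightarrow>
      \<exists>h y. h \<noteq> 0 \<and> y \<in> span (x ` {..c}) \<and> A *\<^sub>v x c = y + h \<cdot>\<^sub>v x (c + 1)"
  shows "j \<le> k \<Longrightarrow> span (x ` {..<j}) = krylov n j A (x 0)"
proof (induction j)
  case 0
  then show ?case by (simp add: krylov_def)
next
  case (Suc j)
  define z where "z = (\<lambda>i. A ^\<^sub>m i *\<^sub>v x 0)"
  have x0: "x 0 \<in> carrier_vec n" using x Suc.prems by simp
  have z: "z i \<in> carrier_vec n" for i
    unfolding z_def using A x0 by (meson mult_mat_vec_carrier pow_carrier_mat)
  have sx: "x ` {..<i} \<subseteq> carrier_vec n" if "i \<le> Suc j" for i
    using x Suc.prems that by auto
  have sz: "z ` {..<i} \<subseteq> carrier_vec n" for i using z by auto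
  have IH: "span (x ` {..<j}) = span (z ` {..<j})"
    using Suc by (simp add: krylov_def z_def)
  have Az: "A *\<^sub>v z i = z (Suc i)" for i
    unfolding z_def using pow_mat_Suc_mult_vec(1)[OF A x0] .
  have "span (x ` {..<Suc j}) = span (z ` {..<Suc j})"
  proof (cases j)
    case 0
    have "z 0 = x 0" unfolding z_def using A x0 by simp
    then show ?thesis using 0 by (simp add: lessThan_Suc)
  next
    case (Suc i)
    obtain h y where h: "h \<noteq> 0" and y: "y \<in> span (x ` {..<j})"
      and Ax: "A *\<^sub>v x i = y + h \<cdot>\<^sub>v x j"
      using step[of i] Suc Suc.prems by (auto simp: lessThan_Suc_atMost)
    have yc: "y \<in> carrier_vec n" using span_closed_ops(4)[OF sx y] by simp
    have xj: "x j \<in> carrier_vec n" using x Suc.prems by simp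
    have mono_x: "span (x ` {..<j}) \<subseteq> span (x ` {..<Suc j})"
      by (intro span_is_monotone image_mono) auto
    have mono_z: "span (z ` {..<j}) \<subseteq> span (z ` {..<Suc j})"
      by (intro span_is_monotone image_mono) auto
    show ?thesis
    proof (rule equalityI)
      have "x i \<in> span (z ` {..<j})"
        using in_own_span[OF sx[of j]] IH Suc by auto
      then have "A *\<^sub>v x i \<in> span (z ` {..<Suc j})"
      proof (rule mult_mat_vec_span[OF A sz sz, rotated])
        fix u assume "u \<in> z ` {..<j}"
        then have "A *\<^sub>v u \<in> z ` {..<Suc j}" using Az by auto
        then show "A *\<^sub>v u \<in> span (z ` {..<Suc j})" using in_own_span[OF sz] by blast
      qed
      moreover have "- 1 \<cdot>\<^sub>v y \<in> span (z ` {..<Suc j})"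
        using span_closed_ops(3)[OF sz] subsetD[OF mono_z] y IH by simp
      ultimately have "(1 / h) \<cdot>\<^sub>v (A *\<^sub>v x i + - 1 \<cdot>\<^sub>v y) \<in> span (z ` {..<Suc j})"
        by (rule span_closed_ops(3)[OF sz span_closed_ops(2)[OF sz]])
      moreover have "x j = (1 / h) \<cdot>\<^sub>v (A *\<^sub>v x i + - 1 \<cdot>\<^sub>v y)"
        unfolding Ax using yc xj h by (intro eq_vecI) auto
      ultimately have "x j \<in> span (z ` {..<Suc j})" by simp
      moreover have "x ` {..<j} \<subseteq> span (z ` {..<Suc j})"
        using in_own_span[OF sx[of j]] IH mono_z by auto
      ultimately have "x ` {..<Suc j} \<subseteq> span (z ` {..<Suc j})"
        by (auto simp: lessThan_Suc)
      then show "span (x ` {..<Suc j}) \<subseteq> span (z ` {..<Suc j})"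
        using span_is_subset[OF _ span_is_submodule[OF sz]] by blast
    next
      have own: "x ` {..<Suc j} \<subseteq> span (x ` {..<Suc j})" by (intro in_own_span sx) simp
      have "z i \<in> span (x ` {..<j})"
        using in_own_span[OF sz[of j]] IH Suc by auto
      then have "A *\<^sub>v z i \<in> span (x ` {..<Suc j})"
      proof (rule mult_mat_vec_span[OF A sx sx, rotated 3])
        fix u assume "u \<in> x ` {..<j}"
        then obtain c where c: "c < j" "u = x c" by auto
        obtain h y where y: "y \<in> span (x ` {..c})"
          and Ax: "A *\<^sub>v x c = y + h \<cdot>\<^sub>v x (c + 1)"
          using step[of c] c Suc.prems by auto
        have "span (x ` {..c}) \<subseteq> span (x ` {..<Suc j})"
          using c by (intro span_is_monotone image_mono) auto
        moreover have "x (c + 1) \<in> span (x ` {..<Suc j})" using own c by auto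
        ultimately show "A *\<^sub>v u \<in> span (x ` {..<Suc j})"
          unfolding c Ax using y by (intro span_closed_ops(2,3)[OF sx]) auto
      qed simp_all
      then have "z j \<in> span (x ` {..<Suc j})" using Az Suc by simp
      moreover have "z ` {..<j} \<subseteq> span (x ` {..<Suc j})"
        using in_own_span[OF sz[of j]] IH mono_x by auto
      ultimately have "z ` {..<Suc j} \<subseteq> span (x ` {..<Suc j})"
        by (auto simp: lessThan_Suc)
      then show "span (z ` {..<Suc j}) \<subseteq> span (x ` {..<Suc j})"
        using span_is_subset[OF _ span_is_submodule[OF sx]] by blast
    qed
  qed
  then show ?case by (simp add: krylov_def z_def)
qed

section \<open>Matrix polynomials applied to a vector\<close>

lemma poly_mat_carrier [simp]:
  "A \<in> carrier_mat n n \<Longrightarrow> poly_mat q A \<in> carrier_mat n n"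
  by (simp add: poly_mat_def)

text \<open>
  The bound \<open>N\<close> may exceed the degree, so that polynomials of different degrees can be compared
  through sums with a common range.
\<close>

lemma poly_mat_mult_vec_index:
  assumes A: "A \<in> carrier_mat n n" and v: "v \<in> carrier_vec n" and i: "i < n"
    and N: "degree q \<le> N"
  shows "(poly_mat q A *\<^sub>v v) $ i = (\<Sum>l\<le>N. coeff q l * (A ^\<^sub>m l *\<^sub>v v) $ i)"
proof -
  have P: "A ^\<^sub>m l \<in> carrier_mat n n" for l using A by simp
  have "(poly_mat q A *\<^sub>v v) $ i
      = (\<Sum>j<n. (\<Sum>l\<le>degree q. coeff q l * (A ^\<^sub>m l) $$ (i, j)) * v $ j)"
    using A v i by (simp add: poly_mat_def scalar_prod_def atLeast0LessThan)
  also have "\<dots> = (\<Sum>l\<le>degree q. coeff q l * (\<Sum>j<n. (A ^\<^sub>m l) $$ (i, j) * v $ j))"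
    by (simp add: sum_distrib_right sum_distrib_left mult.assoc) (rule sum.swap)
  also have "\<dots> = (\<Sum>l\<le>degree q. coeff q l * (A ^\<^sub>m l *\<^sub>v v) $ i)"
    using P v i carrier_matD[OF P]
    by (intro sum.cong refl) (simp add: scalar_prod_def atLeast0LessThan)
  also have "\<dots> = (\<Sum>l\<le>N. coeff q l * (A ^\<^sub>m l *\<^sub>v v) $ i)"
    using N by (intro sum.mono_neutral_left) (auto simp: coeff_eq_0)
  finally show ?thesis .
qed

lemma poly_mat_smult_vec:
  fixes A :: "'a::field mat"
  assumes A: "A \<in> carrier_mat n n" and v: "v \<in> carrier_vec n"
  shows "poly_mat q A *\<^sub>v (c \<cdot>\<^sub>v v) = c \<cdot>\<^sub>v (poly_mat q A *\<^sub>v v)"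
  using mult_mat_vec[OF poly_mat_carrier[OF A] v] .

lemma poly_mat_one:
  assumes A: "A \<in> carrier_mat n n" and v: "v \<in> carrier_vec n"
  shows "poly_mat 1 A *\<^sub>v v = v"
proof (rule eq_vecI)
  fix i assume "i < dim_vec v"
  then show "(poly_mat 1 A *\<^sub>v v) $ i = v $ i"
    using poly_mat_mult_vec_index[OF A v, of i 1 0] A v by simp
qed (use A v in \<open>simp add: poly_mat_def\<close>)

text \<open>
  Splitting off a linear factor on the vector side is the form that an induction on the list of
  shifts consumes; with \<open>a l\<close> an entry of \<open>A\<^sup>l v\<close>, it is an index shift in
  \<open>\<Sum>l. q\<^sub>l (a (l + 1) - \<mu> a l)\<close>.
\<close>

lemma poly_mat_linear_factor:
  fixes A :: "'a::field mat"
  assumes A: "A \<in> carrier_mat n n" and v: "v \<in> carrier_vec n"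
  shows "poly_mat ([:- \<mu>, 1:] * q) A *\<^sub>v v = poly_mat q A *\<^sub>v (A *\<^sub>v v - \<mu> \<cdot>\<^sub>v v)"
proof (rule eq_vecI)
  fix i assume "i < dim_vec (poly_mat q A *\<^sub>v (A *\<^sub>v v - \<mu> \<cdot>\<^sub>v v))"
  then have i: "i < n" using A by (simp add: poly_mat_def)
  define N where "N = degree q"
  define a where "a = (\<lambda>l. (A ^\<^sub>m l *\<^sub>v v) $ i)"
  have P: "A ^\<^sub>m l \<in> carrier_mat n n" for l using A by simp
  have Pd: "dim_row (A ^\<^sub>m l) = n" "dim_col (A ^\<^sub>m l) = n" for l
    using carrier_matD[OF P] by auto
  have Av: "A *\<^sub>v v \<in> carrier_vec n" using A v by simp
  have w: "A *\<^sub>v v - \<mu> \<cdot>\<^sub>v v \<in> carrier_vec n" using A v by simp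
  have aw: "(A ^\<^sub>m l *\<^sub>v (A *\<^sub>v v - \<mu> \<cdot>\<^sub>v v)) $ i = a (Suc l) - \<mu> * a l" for l
  proof -
    have "A ^\<^sub>m l *\<^sub>v (A *\<^sub>v v - \<mu> \<cdot>\<^sub>v v) = A ^\<^sub>m l *\<^sub>v (A *\<^sub>v v) - A ^\<^sub>m l *\<^sub>v (\<mu> \<cdot>\<^sub>v v)"
      using mult_minus_distrib_mat_vec[OF P Av] v by simp
    also have "\<dots> = A ^\<^sub>m Suc l *\<^sub>v v - \<mu> \<cdot>\<^sub>v (A ^\<^sub>m l *\<^sub>v v)"
      using pow_mat_Suc_mult_vec(2)[OF A v] mult_mat_vec[OF P v] by simp
    finally show ?thesis using i Pd A unfolding a_def by simp
  qed
  have deg: "degree ([:- \<mu>, 1:] * q) \<le> Suc N"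
    using degree_mult_le[of "[:- \<mu>, 1:]" q] unfolding N_def by simp
  have top: "coeff q (Suc N) = 0" unfolding N_def by (simp add: coeff_eq_0)
  have "(poly_mat ([:- \<mu>, 1:] * q) A *\<^sub>v v) $ i
      = (\<Sum>l\<le>Suc N. coeff ([:- \<mu>, 1:] * q) l * a l)"
    unfolding a_def by (rule poly_mat_mult_vec_index[OF A v i deg])
  also have "\<dots> = (\<Sum>l\<le>Suc N. coeff (pCons 0 q) l * a l) - (\<Sum>l\<le>Suc N. \<mu> * coeff q l * a l)"
    unfolding sum_subtractf[symmetric] by (intro sum.cong) (auto simp: algebra_simps)
  also have "(\<Sum>l\<le>Suc N. coeff (pCons 0 q) l * a l) = (\<Sum>l\<le>N. coeff q l * a (Suc l))"
    by (subst sum.atMost_Suc_shift) simp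
  also have "(\<Sum>l\<le>Suc N. \<mu> * coeff q l * a l) = (\<Sum>l\<le>N. \<mu> * coeff q l * a l)"
    using top by simp
  also have "(\<Sum>l\<le>N. coeff q l * a (Suc l)) - (\<Sum>l\<le>N. \<mu> * coeff q l * a l)
      = (\<Sum>l\<le>N. coeff q l * (A ^\<^sub>m l *\<^sub>v (A *\<^sub>v v - \<mu> \<cdot>\<^sub>v v)) $ i)"
    unfolding aw sum_subtractf[symmetric] by (intro sum.cong) (auto simp: algebra_simps)
  also have "\<dots> = (poly_mat q A *\<^sub>v (A *\<^sub>v v - \<mu> \<cdot>\<^sub>v v)) $ i"
    by (rule poly_mat_mult_vec_index[OF A w i, symmetric]) (simp add: N_def)
  finally show "(poly_mat ([:- \<mu>, 1:] * q) A *\<^sub>v v) $ i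
      = (poly_mat q A *\<^sub>v (A *\<^sub>v v - \<mu> \<cdot>\<^sub>v v)) $ i" .
qed (use A in \<open>simp add: poly_mat_def\<close>)

section \<open>Hessenberg shape under a QR step\<close>

text \<open>
  The condition leaves column \<open>t - 1\<close> free: for \<open>t = m\<close> and a square matrix of size \<open>m\<close> this is the
  usual notion of an unreduced upper Hessenberg matrix, whose last column is arbitrary.
\<close>

definition unreduced_cols :: "nat \<Rightarrow> nat \<Rightarrow> 'a::zero mat \<Rightarrow> bool" where
  "unreduced_cols m t M \<longleftrightarrow> (\<forall>c. c + 1 < t \<longrightarrow>
     M $$ (c + 1, c) \<noteq> 0 \<and> (\<forall>i. c + 1 < i \<and> i < m \<longrightarrow> M $$ (i, c) = 0))"

text \<open>
  If the columns of \<open>Q\<close> before \<open>c\<close> are Hessenberg, they vanish from row \<open>c + 1\<close> on, so there the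
  entries of column \<open>c\<close> of \<open>Q R\<close> are those of \<open>Q\<close> times the diagonal entry of \<open>R\<close>. The nonzero
  subdiagonal entry of \<open>Q R\<close> forces both factors to be nonzero, and the zeros below it pass to \<open>Q\<close>.
\<close>

lemma unreduced_cols_QR:
  fixes Q R :: "'a::idom mat"
  assumes Q: "Q \<in> carrier_mat m m" and R: "R \<in> carrier_mat m m" and tri: "upper_triangular R"
    and t: "t \<le> m" and G: "unreduced_cols m t (Q * R)"
  shows "unreduced_cols m t Q" and "\<And>c. c + 1 < t \<Longrightarrow> R $$ (c, c) \<noteq> 0"
proof -
  have main: "R $$ (c, c) \<noteq> 0 \<and> Q $$ (c + 1, c) \<noteq> 0 \<and>
      (\<forall>i. c + 1 < i \<and> i < m \<longrightarrow> Q $$ (i, c) = 0)" if "c + 1 < t" for c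
    using that
  proof (induction c rule: less_induct)
    case (less c)
    have entry: "(Q * R) $$ (i, c) = Q $$ (i, c) * R $$ (c, c)" if "c + 1 \<le> i" "i < m" for i
    proof -
      have "(Q * R) $$ (i, c) = (\<Sum>l<m. Q $$ (i, l) * R $$ (l, c))"
        using Q R that by (simp add: scalar_prod_def atLeast0LessThan)
      also have "\<dots> = (\<Sum>l\<in>{c}. Q $$ (i, l) * R $$ (l, c))"
      proof (intro sum.mono_neutral_right ballI)
        fix l assume l: "l \<in> {..<m} - {c}"
        show "Q $$ (i, l) * R $$ (l, c) = 0"
        proof (cases "l < c")
          case True
          then show ?thesis using less that by simp
        next
          case False
          then show ?thesis using upper_triangularD[OF tri, of c l] l R by simp
        qed
      qed (use that in auto)
      finally show ?thesis by simp
    qed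
    have "(Q * R) $$ (c + 1, c) \<noteq> 0"
      and "\<And>i. c + 1 < i \<Longrightarrow> i < m \<Longrightarrow> (Q * R) $$ (i, c) = 0"
      using G less.prems unfolding unreduced_cols_def by auto
    then show ?case using entry less.prems t by auto
  qed
  then show "unreduced_cols m t Q" and "\<And>c. c + 1 < t \<Longrightarrow> R $$ (c, c) \<noteq> 0"
    unfolding unreduced_cols_def by auto
qed

text \<open>
  The subdiagonal entry of column \<open>c\<close> of \<open>R Q\<close> is the subdiagonal entry of \<open>Q\<close> times
  \<open>R $$ (c + 1, c + 1)\<close>. The diagonal entry comes from the next column, which is why a QR step
  preserves the shape of one column fewer than it started with.
\<close>

lemma unreduced_cols_RQ:
  fixes Q R :: "'a::idom mat"
  assumes Q: "Q \<in> carrier_mat m m" and R: "R \<in> carrier_mat m m" and tri: "upper_triangular R"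
    and t: "t < m" and U: "unreduced_cols m t Q" and D: "\<And>c. c < t \<Longrightarrow> R $$ (c, c) \<noteq> 0"
  shows "unreduced_cols m t (R * Q)"
  unfolding unreduced_cols_def
proof (intro allI impI conjI)
  fix c assume c: "c + 1 < t"
  have entry: "R $$ (i, l) * Q $$ (l, c) = 0" if "c + 1 \<le> i" "i < m" "l < m" "l \<noteq> i \<or> i > c + 1" for i l
  proof (cases "l < i")
    case True
    then show ?thesis using upper_triangularD[OF tri, of l i] that R by simp
  next
    case False
    then have "c + 1 < l" using that by auto
    then show ?thesis using U c that unfolding unreduced_cols_def by simp
  qed
  have sum: "(R * Q) $$ (i, c) = (\<Sum>l<m. R $$ (i, l) * Q $$ (l, c))" if "i < m" for i
    using Q R that c t by (simp add: scalar_prod_def atLeast0LessThan)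
  show "(R * Q) $$ (i, c) = 0" if "c + 1 < i \<and> i < m" for i
    using that sum[of i] entry[of i] by simp
  have "(R * Q) $$ (c + 1, c) = (\<Sum>l\<in>{c + 1}. R $$ (c + 1, l) * Q $$ (l, c))"
    unfolding sum[of "c + 1", OF less_trans[OF c t]]
    using c t entry[of "c + 1"] by (intro sum.mono_neutral_right) auto
  also have "\<dots> \<noteq> 0" using U D[of "c + 1"] c unfolding unreduced_cols_def by simp
  finally show "(R * Q) $$ (c + 1, c) \<noteq> 0" .
qed

lemma unreduced_cols_shift:
  fixes M :: "'a::comm_ring_1 mat"
  assumes "M \<in> carrier_mat m m" and "t \<le> m"
  shows "unreduced_cols m t (M - \<mu> \<cdot>\<^sub>m 1\<^sub>m m) \<longleftrightarrow> unreduced_cols m t M"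
    and "unreduced_cols m t (M + \<mu> \<cdot>\<^sub>m 1\<^sub>m m) \<longleftrightarrow> unreduced_cols m t M"
  using assms unfolding unreduced_cols_def by auto

section \<open>Shifted QR steps on an Arnoldi relation\<close>

text \<open>
  Only the columns \<open>c\<close> with \<open>c + 1 < t\<close> obey the relation. In an Arnoldi factorization this excludes
  exactly the column that carries the residual.
\<close>

definition arnoldi_prefix where
  "arnoldi_prefix n m t A V H \<longleftrightarrow> A \<in> carrier_mat n n \<and> V \<in> carrier_mat n m \<and>
     H \<in> carrier_mat m m \<and> t \<le> m \<and> unreduced_cols m t H \<and>
     (\<forall>c. c + 1 < t \<longrightarrow> A *\<^sub>v col V c = V *\<^sub>v col H c)"

lemma mult_mat_vec_cong_supp:
  assumes "dim_row A = dim_row B" "dim_col A = dim_vec w" "dim_col B = dim_vec w"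
    and "\<And>l. l < dim_vec w \<Longrightarrow> w $ l \<noteq> 0 \<Longrightarrow> col A l = col B l"
  shows "A *\<^sub>v w = B *\<^sub>v w"
proof (rule eq_vecI)
  fix i assume i: "i < dim_vec (B *\<^sub>v w)"
  have "A $$ (i, l) * w $ l = B $$ (i, l) * w $ l" if "l < dim_vec w" for l
    using assms(4)[OF that] assms(1-3) i that
    by (metis dim_mult_mat_vec index_col mult_zero_right)
  then show "(A *\<^sub>v w) $ i = (B *\<^sub>v w) $ i"
    using i assms by (simp add: scalar_prod_def)
qed (use assms in simp)

text \<open>
  The relation \<open>(A - \<mu> I) V = (V Q) R\<close> holds in the columns below \<open>t\<close>. Multiplied by column \<open>c\<close> of
  \<open>Q\<close>, which is supported on the rows up to \<open>c + 1\<close>, it gives the new Arnoldi relation for column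
  \<open>c\<close> as long as \<open>c + 1 < t\<close>.
\<close>

lemma arnoldi_prefix_step:
  fixes A V H Q R :: "'a::conjugatable_field mat"
  assumes P: "arnoldi_prefix n m (Suc t) A V H" and t: "1 \<le> t"
    and Q: "unitary_mat m Q" and R: "R \<in> carrier_mat m m" and tri: "upper_triangular R"
    and QR: "H - \<mu> \<cdot>\<^sub>m 1\<^sub>m m = Q * R"
  shows "arnoldi_prefix n m t A (V * Q) (mat_adjoint Q * H * Q)"
    and "R $$ (0, 0) \<noteq> 0"
    and "R $$ (0, 0) \<cdot>\<^sub>v col (V * Q) 0 = A *\<^sub>v col V 0 - \<mu> \<cdot>\<^sub>v col V 0"
proof -
  have A: "A \<in> carrier_mat n n" and V: "V \<in> carrier_mat n m" and H: "H \<in> carrier_mat m m"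
    and tm: "t < m" and UH: "unreduced_cols m (Suc t) H"
    and rel: "\<And>c. c < t \<Longrightarrow> A *\<^sub>v col V c = V *\<^sub>v col H c"
    using P unfolding arnoldi_prefix_def by auto
  have Qc: "Q \<in> carrier_mat m m" and QQ: "mat_adjoint Q * Q = 1\<^sub>m m"
    using Q unfolding unitary_mat_def by auto
  have Qa: "mat_adjoint Q \<in> carrier_mat m m"
    using Qc unfolding mat_adjoint_def by (intro carrier_matI) auto
  have RQ: "R * Q \<in> carrier_mat m m" using R Qc by simp
  have VQ: "V * Q \<in> carrier_mat n m" using V Qc by simp
  have HQR: "H = Q * R + \<mu> \<cdot>\<^sub>m 1\<^sub>m m"
    unfolding QR[symmetric] using H by (intro eq_matI) auto
  have H': "mat_adjoint Q * H * Q = R * Q + \<mu> \<cdot>\<^sub>m 1\<^sub>m m"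
  proof -
    have "mat_adjoint Q * H = mat_adjoint Q * (Q * R) + mat_adjoint Q * (\<mu> \<cdot>\<^sub>m 1\<^sub>m m)"
      unfolding HQR using Qa Qc R by (intro mult_add_distrib_mat) auto
    also have "mat_adjoint Q * (Q * R) = R"
      using assoc_mult_mat[OF Qa Qc R] QQ R by simp
    also have "mat_adjoint Q * (\<mu> \<cdot>\<^sub>m 1\<^sub>m m) = \<mu> \<cdot>\<^sub>m mat_adjoint Q"
      using Qa by (simp add: mult_smult_distrib[OF Qa one_carrier_mat])
    finally have "mat_adjoint Q * H * Q = (R + \<mu> \<cdot>\<^sub>m mat_adjoint Q) * Q" by simp
    also have "\<dots> = R * Q + \<mu> \<cdot>\<^sub>m mat_adjoint Q * Q"
      using R Qa Qc by (intro add_mult_distrib_mat) auto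
    also have "\<mu> \<cdot>\<^sub>m mat_adjoint Q * Q = \<mu> \<cdot>\<^sub>m 1\<^sub>m m"
      using mult_smult_assoc_mat[OF Qa Qc] QQ by simp
    finally show ?thesis .
  qed
  have UQR: "unreduced_cols m (Suc t) (Q * R)"
    unfolding QR[symmetric] using UH unreduced_cols_shift(1)[OF H] tm by simp
  note UQ = unreduced_cols_QR[OF Qc R tri Suc_leI[OF tm] UQR]
  show R0: "R $$ (0, 0) \<noteq> 0" using UQ(2)[of 0] t by simp
  have UQ': "unreduced_cols m t Q" using UQ(1) unfolding unreduced_cols_def by simp
  have UH': "unreduced_cols m t (R * Q + \<mu> \<cdot>\<^sub>m 1\<^sub>m m)"
    using unreduced_cols_RQ[OF Qc R tri tm UQ' UQ(2)] unreduced_cols_shift(2)[OF RQ] tm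
    by simp
  have shifted: "A *\<^sub>v col V c - \<mu> \<cdot>\<^sub>v col V c = (V * Q) *\<^sub>v col R c" if "c < t" for c
  proof -
    have cm: "c < m" using that tm by simp
    have "col H c = col (Q * R) c + \<mu> \<cdot>\<^sub>v unit_vec m c"
      unfolding HQR using Qc R cm by (intro eq_vecI) (auto simp: unit_vec_def)
    also have "col (Q * R) c = Q *\<^sub>v col R c" using col_mult2[OF Qc R cm] .
    finally have "V *\<^sub>v col H c = V *\<^sub>v (Q *\<^sub>v col R c) + \<mu> \<cdot>\<^sub>v col V c"
      using V Qc R cm by (simp add: mult_add_distrib_mat_vec mult_mat_vec mat_unit_vec_col)
    also have "V *\<^sub>v (Q *\<^sub>v col R c) = (V * Q) *\<^sub>v col R c"
      using assoc_mult_mat_vec[OF V Qc, of "col R c"] R by (simp add: carrier_vecI)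
    finally show ?thesis
      unfolding rel[OF that] using V VQ R by (intro eq_vecI) auto
  qed
  have "col R 0 = R $$ (0, 0) \<cdot>\<^sub>v unit_vec m 0"
    using R tm upper_triangularD[OF tri] by (intro eq_vecI) auto
  then have "(V * Q) *\<^sub>v col R 0 = R $$ (0, 0) \<cdot>\<^sub>v col (V * Q) 0"
    using VQ tm by (simp add: mult_mat_vec mat_unit_vec_col)
  then show "R $$ (0, 0) \<cdot>\<^sub>v col (V * Q) 0 = A *\<^sub>v col V 0 - \<mu> \<cdot>\<^sub>v col V 0"
    using shifted[of 0] t by simp
  have "A *\<^sub>v col (V * Q) c = (V * Q) *\<^sub>v col (R * Q + \<mu> \<cdot>\<^sub>m 1\<^sub>m m) c" if c: "c + 1 < t" for c
  proof -
    have cm: "c < m" using c tm by simp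
    have qc: "col Q c \<in> carrier_vec m" using Qc by (simp add: carrier_vecI)
    have AV: "A * V \<in> carrier_mat n m" using A V by simp
    have "(A * V - \<mu> \<cdot>\<^sub>m V) *\<^sub>v col Q c = ((V * Q) * R) *\<^sub>v col Q c"
    proof (rule mult_mat_vec_cong_supp)
      fix l assume l: "l < dim_vec (col Q c)" and nz: "col Q c $ l \<noteq> 0"
      have lm: "l < m" using l Qc by simp
      \<comment> \<open>Hessenberg shape of \<open>Q\<close>: only columns in which the relation is known contribute.\<close>
      have "l \<le> c + 1"
        using nz UQ(1) c lm Qc cm unfolding unreduced_cols_def
        by (metis Suc_eq_plus1 carrier_matD index_col less_SucI not_le)
      then have lt: "l < t" using c by simp
      have "col (A * V - \<mu> \<cdot>\<^sub>m V) l = A *\<^sub>v col V l - \<mu> \<cdot>\<^sub>v col V l"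
        using A V lm by (intro eq_vecI) auto
      also have "\<dots> = col ((V * Q) * R) l"
        using shifted[OF lt] col_mult2[OF VQ R lm] by simp
      finally show "col (A * V - \<mu> \<cdot>\<^sub>m V) l = col ((V * Q) * R) l" .
    qed (use A V Qc R in auto)
    moreover have "(A * V - \<mu> \<cdot>\<^sub>m V) *\<^sub>v col Q c = A *\<^sub>v col (V * Q) c - \<mu> \<cdot>\<^sub>v col (V * Q) c"
    proof -
      have "(A * V - \<mu> \<cdot>\<^sub>m V) *\<^sub>v col Q c = (A * V) *\<^sub>v col Q c - (\<mu> \<cdot>\<^sub>m V) *\<^sub>v col Q c"
        using AV V qc by (intro minus_mult_distrib_mat_vec) auto
      also have "(A * V) *\<^sub>v col Q c = A *\<^sub>v col (V * Q) c"
        using assoc_mult_mat_vec[OF A V qc] col_mult2[OF V Qc cm] by simp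
      also have "(\<mu> \<cdot>\<^sub>m V) *\<^sub>v col Q c = \<mu> \<cdot>\<^sub>v col (V * Q) c"
        using col_mult2[OF V Qc cm] V Qc cm by (intro eq_vecI) auto
      finally show ?thesis .
    qed
    moreover have "((V * Q) * R) *\<^sub>v col Q c = (V * Q) *\<^sub>v col (R * Q) c"
      using assoc_mult_mat_vec[OF VQ R qc] col_mult2[OF R Qc cm] by simp
    ultimately have eq: "A *\<^sub>v col (V * Q) c - \<mu> \<cdot>\<^sub>v col (V * Q) c = (V * Q) *\<^sub>v col (R * Q) c"
      by simp
    have "col (R * Q + \<mu> \<cdot>\<^sub>m 1\<^sub>m m) c = col (R * Q) c + \<mu> \<cdot>\<^sub>v unit_vec m c"
      using Qc R cm by (intro eq_vecI) (auto simp: unit_vec_def)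
    then have "(V * Q) *\<^sub>v col (R * Q + \<mu> \<cdot>\<^sub>m 1\<^sub>m m) c
        = (V * Q) *\<^sub>v col (R * Q) c + \<mu> \<cdot>\<^sub>v col (V * Q) c"
      using VQ RQ cm by (simp add: mult_add_distrib_mat_vec mult_mat_vec mat_unit_vec_col)
    also have "\<dots> = A *\<^sub>v col (V * Q) c"
      unfolding eq[symmetric] using A VQ by (intro eq_vecI) auto
    finally show ?thesis by simp
  qed
  then show "arnoldi_prefix n m t A (V * Q) (mat_adjoint Q * H * Q)"
    unfolding arnoldi_prefix_def H' using A VQ RQ tm UH' by auto
qed

text \<open>
  The constant is \<open>\<rho> = \<Prod> 1 / R\<^sup>i\<^sub>1\<^sub>1\<close> over the steps. Since \<open>k \<ge> 1\<close>, before each step at least two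
  columns are still under control, which makes its \<open>R\<^sub>1\<^sub>1\<close> nonzero.
\<close>

lemma shifted_qr_prefix:
  fixes A V H :: "'a::conjugatable_field mat"
  assumes "shifted_qr m H mus H' W" and "arnoldi_prefix n m (k + length mus) A V H" and "1 \<le> k"
  shows "W \<in> carrier_mat m m \<and> arnoldi_prefix n m k A (V * W) H' \<and>
    (\<exists>\<rho>. \<rho> \<noteq> 0 \<and> col (V * W) 0 = \<rho> \<cdot>\<^sub>v (poly_mat (shift_poly mus) A *\<^sub>v col V 0))"
  using assms
proof (induction arbitrary: V rule: shifted_qr.induct)
  case (Nil H)
  then have A: "A \<in> carrier_mat n n" and V: "V \<in> carrier_mat n m"
    unfolding arnoldi_prefix_def by auto
  have "poly_mat (shift_poly []) A *\<^sub>v col V 0 = col V 0"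
    using poly_mat_one[OF A, of "col V 0"] V by (simp add: shift_poly_def carrier_vecI)
  then show ?case using Nil V by (auto intro!: exI[of _ 1])
next
  case (Cons Q R H \<mu> mus H' W)
  have P: "arnoldi_prefix n m (Suc (k + length mus)) A V H" using Cons.prems by simp
  then have A: "A \<in> carrier_mat n n" and V: "V \<in> carrier_mat n m"
    unfolding arnoldi_prefix_def by auto
  have Q: "Q \<in> carrier_mat m m" using Cons.hyps unfolding unitary_mat_def by simp
  have "1 \<le> k + length mus" using Cons.prems by simp
  note step = arnoldi_prefix_step[OF P this Cons.hyps(1-4)]
  obtain \<rho> where W: "W \<in> carrier_mat m m" and pre: "arnoldi_prefix n m k A (V * Q * W) H'"
    and \<rho>: "\<rho> \<noteq> 0"
    and first: "col (V * Q * W) 0 = \<rho> \<cdot>\<^sub>v (poly_mat (shift_poly mus) A *\<^sub>v col (V * Q) 0)"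
    using Cons.IH[OF step(1) Cons.prems(2)] by blast
  have assoc: "V * Q * W = V * (Q * W)" using V Q W by simp
  let ?r = "R $$ (0, 0)"
  note r = step(2)
  have q0: "col (V * Q) 0 \<in> carrier_vec n" and v0: "col V 0 \<in> carrier_vec n"
    using V Q by (auto intro!: carrier_vecI)
  have "poly_mat (shift_poly (\<mu> # mus)) A *\<^sub>v col V 0
      = poly_mat (shift_poly mus) A *\<^sub>v (A *\<^sub>v col V 0 - \<mu> \<cdot>\<^sub>v col V 0)"
    unfolding shift_poly_def list.map prod_list.Cons by (rule poly_mat_linear_factor[OF A v0])
  also have "\<dots> = ?r \<cdot>\<^sub>v (poly_mat (shift_poly mus) A *\<^sub>v col (V * Q) 0)"
    unfolding step(3)[symmetric] by (rule poly_mat_smult_vec[OF A q0])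
  finally have "col (V * (Q * W)) 0
      = (\<rho> / ?r) \<cdot>\<^sub>v (poly_mat (shift_poly (\<mu> # mus)) A *\<^sub>v col V 0)"
    using first r assoc by (simp add: smult_smult_assoc)
  then show ?case using Q W pre assoc \<rho> r by (auto intro!: exI[of _ "\<rho> / ?r"])
qed

lemma arnoldi_prefix_span:
  fixes A V H :: "'a::field mat"
  assumes P: "arnoldi_prefix n m k A V H"
  shows "vspan n (col V ` {..<k}) = krylov n k A (col V 0)"
proof -
  interpret vec_space "TYPE('a)" n .
  have A: "A \<in> carrier_mat n n" and V: "V \<in> carrier_mat n m" and H: "H \<in> carrier_mat m m"
    and km: "k \<le> m" and UH: "unreduced_cols m k H"
    and rel: "\<And>c. c + 1 < k \<Longrightarrow> A *\<^sub>v col V c = V *\<^sub>v col H c"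
    using P unfolding arnoldi_prefix_def by auto
  show ?thesis
  proof (rule krylov_eq_span[OF A])
    fix c assume c: "c + 1 < k"
    define h where "h = H $$ (c + 1, c)"
    \<comment> \<open>The part of column \<open>c\<close> of \<open>H\<close> above the subdiagonal.\<close>
    define w where "w = vec m (\<lambda>l. if l \<le> c then H $$ (l, c) else 0)"
    have w: "w \<in> carrier_vec m" unfolding w_def by simp
    have "V *\<^sub>v w \<in> span (col V ` {..<Suc c})"
      using c km by (intro mult_mat_vec_in_span_cols[OF V w]) (auto simp: w_def)
    moreover have "col H c = w + h \<cdot>\<^sub>v unit_vec m (c + 1)"
      using UH H c km unfolding unreduced_cols_def w_def h_def
      by (intro eq_vecI) (auto simp: not_le)
    then have "A *\<^sub>v col V c = V *\<^sub>v w + h \<cdot>\<^sub>v col V (c + 1)"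
      unfolding rel[OF c] using V w c km
      by (simp add: mult_add_distrib_mat_vec mult_mat_vec mat_unit_vec_col)
    moreover have "h \<noteq> 0" using UH c unfolding unreduced_cols_def h_def by simp
    ultimately show "\<exists>h y. h \<noteq> 0 \<and> y \<in> span (col V ` {..c}) \<and>
        A *\<^sub>v col V c = y + h \<cdot>\<^sub>v col V (c + 1)"
      unfolding lessThan_Suc_atMost by blast
  next
    show "col V c \<in> carrier_vec n" if "c < k" for c
      using V by (simp add: carrier_vecI)
  qed simp
qed

lemma shifted_qr_krylov:
  fixes A V H :: "'a::conjugatable_field mat"
  assumes run: "shifted_qr m H mus H' Q" and P: "arnoldi_prefix n m (k + length mus) A V H"
    and k: "1 \<le> k"
  shows "\<exists>\<rho>. \<rho> \<noteq> 0 \<and>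
    (V * Q) *\<^sub>v unit_vec m 0 = \<rho> \<cdot>\<^sub>v (poly_mat (shift_poly mus) A *\<^sub>v col V 0) \<and>
    vspan n ((\<lambda>j. (V * Q) *\<^sub>v unit_vec m j) ` {..<k}) =
      krylov n k A (\<rho> \<cdot>\<^sub>v (poly_mat (shift_poly mus) A *\<^sub>v col V 0))"
proof -
  obtain \<rho> where pre: "arnoldi_prefix n m k A (V * Q) H'" and \<rho>: "\<rho> \<noteq> 0"
    and first: "col (V * Q) 0 = \<rho> \<cdot>\<^sub>v (poly_mat (shift_poly mus) A *\<^sub>v col V 0)"
    using shifted_qr_prefix[OF run P k] by blast
  have VQ: "V * Q \<in> carrier_mat n m" and km: "k \<le> m"
    using pre unfolding arnoldi_prefix_def by auto
  have col: "(V * Q) *\<^sub>v unit_vec m j = col (V * Q) j" if "j < k" for j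
    using mat_unit_vec_col[OF VQ] that km by simp
  have "vspan n ((\<lambda>j. (V * Q) *\<^sub>v unit_vec m j) ` {..<k}) = krylov n k A (col (V * Q) 0)"
    unfolding arnoldi_prefix_span[OF pre, symmetric]
    by (rule arg_cong[where f = "vspan n"], rule image_cong) (simp_all add: col)
  then show ?thesis using \<rho> first col[of 0] k by (intro exI[of _ \<rho>]) simp
qed

section \<open>Implicitly restarted randomized Arnoldi\<close>

lemma randomized_arnoldi_prefix:
  assumes "randomized_arnoldi n d m \<epsilon> \<Omega> A v\<^sub>1 V H r"
  shows "arnoldi_prefix n m m A V H"
proof -
  have A: "A \<in> carrier_mat n n" and V: "V \<in> carrier_mat n m" and H: "H \<in> carrier_mat m m"
    and r: "r \<in> carrier_vec n"
    and eq: "A * V = V * H + mat_of_cols n [r] * mat_of_rows m [unit_vec m (m - 1)]"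
    and hess: "upper_hessenberg H" "\<And>i. i + 1 < m \<Longrightarrow> H $$ (i + 1, i) > 0"
    using assms unfolding randomized_arnoldi_def by auto
  have "unreduced_cols m m H"
    using hess H unfolding unreduced_cols_def upper_hessenberg_def by fastforce
  moreover have "A *\<^sub>v col V c = V *\<^sub>v col H c" if c: "c + 1 < m" for c
  proof (rule eq_vecI)
    fix i assume "i < dim_vec (V *\<^sub>v col H c)"
    then have i: "i < n" using V by simp
    have "(A * V) $$ (i, c) = (V * H) $$ (i, c)"
      unfolding eq using i c V H by (simp add: scalar_prod_def mat_of_rows_index)
    then show "(A *\<^sub>v col V c) $ i = (V *\<^sub>v col H c) $ i"
      using A V H i c by simp
  qed (use A V in simp)
  ultimately show ?thesis unfolding arnoldi_prefix_def using A V H by simp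
qed

lemma arnoldi_prefix_of_real:
  assumes "arnoldi_prefix n m t A V H"
  shows "arnoldi_prefix n m t (map_mat complex_of_real A) (map_mat of_real V) (map_mat of_real H)"
proof -
  have A: "A \<in> carrier_mat n n" and V: "V \<in> carrier_mat n m" and H: "H \<in> carrier_mat m m"
    and tm: "t \<le> m" and UH: "unreduced_cols m t H"
    and rel: "\<And>c. c + 1 < t \<Longrightarrow> A *\<^sub>v col V c = V *\<^sub>v col H c"
    using assms unfolding arnoldi_prefix_def by auto
  have "map_mat complex_of_real A *\<^sub>v col (map_mat of_real V) c
      = map_mat of_real V *\<^sub>v col (map_mat of_real H) c" if c: "c + 1 < t" for c
  proof -
    have "col (map_mat complex_of_real V) c = map_vec of_real (col V c)"
      "col (map_mat complex_of_real H) c = map_vec of_real (col H c)"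
      using V H c tm by auto
    moreover have "map_vec complex_of_real (A *\<^sub>v col V c) = map_vec of_real (V *\<^sub>v col H c)"
      using rel[OF c] by simp
    ultimately show ?thesis
      using V H of_real_hom.mult_mat_vec_hom[OF A, of "col V c"]
        of_real_hom.mult_mat_vec_hom[OF V, of "col H c"]
      by (metis carrier_matD(1) carrier_vecI col_dim dim_col)
  qed
  moreover have "unreduced_cols m t (map_mat complex_of_real H)"
    using UH H tm unfolding unreduced_cols_def by auto
  ultimately show ?thesis using A V H tm unfolding arnoldi_prefix_def by simp
qed

theorem mainTheorem6:
  fixes n d k p :: nat
    and \<epsilon> :: real
    and \<Omega> A V H :: "real mat"
    and v\<^sub>1 r :: "real vec"
  assumes "k \<ge> 1"
    and "randomized_arnoldi n d (k + p) \<epsilon> \<Omega> A v\<^sub>1 V H r"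
  shows
    "(\<forall>(mus :: real list) H' Q.
        length mus = p \<and> shifted_qr (k + p) H mus H' Q \<longrightarrow>
        (\<exists>\<rho>. \<rho> \<noteq> 0 \<and>
           (V * Q) *\<^sub>v unit_vec (k + p) 0 = \<rho> \<cdot>\<^sub>v (poly_mat (shift_poly mus) A *\<^sub>v v\<^sub>1) \<and>
           vspan n ((\<lambda>j. (V * Q) *\<^sub>v unit_vec (k + p) j) ` {..<k}) =
             krylov n k A (\<rho> \<cdot>\<^sub>v (poly_mat (shift_poly mus) A *\<^sub>v v\<^sub>1))))
     \<and>
     (\<forall>(mus :: complex list) H' Q A\<^sub>c V\<^sub>c H\<^sub>c v\<^sub>c.
        A\<^sub>c = map_mat of_real A \<and> V\<^sub>c = map_mat of_real V \<and>
        H\<^sub>c = map_mat of_real H \<and> v\<^sub>c = map_vec of_real v\<^sub>1 \<and>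
        length mus = p \<and> shifted_qr (k + p) H\<^sub>c mus H' Q \<longrightarrow>
        (\<exists>\<rho>. \<rho> \<noteq> 0 \<and>
           (V\<^sub>c * Q) *\<^sub>v unit_vec (k + p) 0 = \<rho> \<cdot>\<^sub>v (poly_mat (shift_poly mus) A\<^sub>c *\<^sub>v v\<^sub>c) \<and>
           vspan n ((\<lambda>j. (V\<^sub>c * Q) *\<^sub>v unit_vec (k + p) j) ` {..<k}) =
             krylov n k A\<^sub>c (\<rho> \<cdot>\<^sub>v (poly_mat (shift_poly mus) A\<^sub>c *\<^sub>v v\<^sub>c))))"
proof -
  have P: "arnoldi_prefix n (k + p) (k + p) A V H"
    using randomized_arnoldi_prefix[OF assms(2)] .
  note Pc = arnoldi_prefix_of_real[OF P]
  have v1: "col V 0 = v\<^sub>1" and V: "V \<in> carrier_mat n (k + p)"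
    using assms(2) unfolding randomized_arnoldi_def by auto
  have v1c: "col (map_mat complex_of_real V) 0 = map_vec of_real v\<^sub>1"
    using V assms(1) unfolding v1[symmetric] by auto
  show ?thesis
    using shifted_qr_krylov[of "k + p" H _ _ _ n k A V] P assms(1)
      shifted_qr_krylov[of "k + p" "map_mat complex_of_real H" _ _ _ n k
        "map_mat of_real A" "map_mat of_real V"] Pc
    unfolding v1 v1c by blast
qed

end
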